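(* Let $n\ge 3$. The dihedral group $D_n\le S_n$ is generated by a right generalized Smarandache palindromic permutation and a left generalized Smarandache palindromic permutation; that is, there exist $\sigma\in GSPP_\rho(S_n)$ and $\tau\in GSPP_\lambda(S_n)$ such that $D_n=\langle\sigma,\tau\rangle$.
   Context: $S_n$ is the group of permutations of $\{1,\dots,n\}$ under composition. $D_n$ is the subgroup of $S_n$ consisting of the symmetries (distance-preserving permutations) of the set of vertices of a regular $n$-gon labelled $1,2,\dots,n$ in cyclic order; it has order $2n$. For $\sigma\in S_n$ put $N_\lambda(\sigma)=1\,2\cdots n\,\sigma(n)\,\sigma(n-1)\cdots\sigma(1)$ and $N_\rho(\sigma)=1\,2\cdots n\,\sigma(1)\,\sigma(2)\cdots\sigma(n)$, regarded as words of length $2n$ over the alphabet $\{1,\dots,n\}$, each integer counting as a single symbol. A word is a generalized Smarandache palindrome (GSP) if it can be split into consecutive non-empty blocks so that it has the form $a_1a_2\cdots a_ka_k\cdots a_2a_1$ ($k\ge1$) or $a_1a_2\cdots a_{k-1}a_ka_{k-1}\cdots a_2a_1$ ($k\ge2$), where each block $a_i$ is a non-empty word of one or more symbols (the trivial splitting into a single block is excluded). $GSPP_\lambda(S_n)$ is the set of $\sigma\in S_n$ for which $N_\lambda(\sigma)$ is a GSP (such $\sigma$ are called left generalized Smarandache palindromic permutations), and $GSPP_\rho(S_n)$ is the set of $\sigma\in S_n$ for which $N_\rho(\sigma)$ is a GSP (right generalized Smarandache palindromic permutations). *)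

theory Defs
  imports Complex_Main "HOL-Algebra.Sym_Groups" "HOL-Algebra.Generated_Groups"
begin

text \<open>The \<open>i\<close>-th vertex of a regular \<open>n\<close>-gon inscribed in the unit circle.\<close>

definition ngon_vertex :: "nat \<Rightarrow> nat \<Rightarrow> complex" where
  "ngon_vertex n i = cis (2 * pi * real i / real n)"

definition dihedral :: "nat \<Rightarrow> (nat \<Rightarrow> nat) set" where
  "dihedral n = {p \<in> carrier (sym_group n). \<forall>i\<in>{1..n}. \<forall>j\<in>{1..n}.
     dist (ngon_vertex n (p i)) (ngon_vertex n (p j)) = dist (ngon_vertex n i) (ngon_vertex n j)}"

definition N_left :: "nat \<Rightarrow> (nat \<Rightarrow> nat) \<Rightarrow> nat list" where
  "N_left n p = [1..<Suc n] @ map p (rev [1..<Suc n])"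

definition N_right :: "nat \<Rightarrow> (nat \<Rightarrow> nat) \<Rightarrow> nat list" where
  "N_right n p = [1..<Suc n] @ map p [1..<Suc n]"

text \<open>The list \<open>as\<close> holds the blocks that occur twice; it must be non-empty in the odd form too,
  which excludes the trivial splitting into a single block.\<close>

definition is_GSP :: "'a list \<Rightarrow> bool" where
  "is_GSP w \<longleftrightarrow> (\<exists>as. as \<noteq> [] \<and> [] \<notin> set as \<and>
     (w = concat (as @ rev as) \<or> (\<exists>c. c \<noteq> [] \<and> w = concat (as @ [c] @ rev as))))"

definition GSPP_left :: "nat \<Rightarrow> (nat \<Rightarrow> nat) set" where
  "GSPP_left n = {p \<in> carrier (sym_group n). is_GSP (N_left n p)}"

definition GSPP_right :: "nat \<Rightarrow> (nat \<Rightarrow> nat) set" where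
  "GSPP_right n = {p \<in> carrier (sym_group n). is_GSP (N_right n p)}"

end

theory Submission
  imports Defs "HOL-Analysis.Complex_Transcendental"
begin

text \<open>A word whose first and last symbols agree is a GSP as soon as it has a third symbol in between,
  so the rotation \<open>r\<close> with \<open>r n = 1\<close> is a right and the reflection \<open>s\<close> fixing \<open>1\<close> is a left GSPP.
  They generate the dihedral group: composing a symmetry with powers of \<open>r\<close> makes it fix the
  vertex \<open>1\<close>, composing it with \<open>s\<close> makes it fix the neighbour \<open>2\<close> as well, and a symmetry fixing
  two adjacent vertices is the identity, every vertex being determined by its distances to them.\<close>

definition ngon_rotation :: "nat \<Rightarrow> nat \<Rightarrow> nat" where
  "ngon_rotation n i = (if i \<in> {1..<n} then i + 1 else if i = n then 1 else i)"

text \<open>This is i sent to 2 - i modulo n, the reflection in the axis through vertex 1. Vertex 1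
  is left to the else branch because n + 2 - 1 would leave the range of labels.\<close>

definition ngon_reflection :: "nat \<Rightarrow> nat \<Rightarrow> nat" where
  "ngon_reflection n i = (if i \<in> {2..n} then n + 2 - i else i)"

lemma is_GSP_Cons_snoc:
  assumes "w \<noteq> []"
  shows "is_GSP (x # w @ [x])"
  \<comment> \<open>The odd form, with \<open>[x]\<close> as the only doubled block and
    \<open>w\<close> in the middle.\<close>
  unfolding is_GSP_def using assms by (intro exI[of _ "[[x]]"]) auto

text \<open>The right word ends with \<open>p n\<close> and the left word with \<open>p 1\<close>,
  so it is these values that must match the leading 1.\<close>

lemma N_right_GSP:
  assumes "n \<ge> 2" "p n = 1"
  shows "is_GSP (N_right n p)"
proof -
  have "N_right n p = 1 # ([2..<Suc n] @ map p [1..<n]) @ [1]"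
    using assms by (simp add: N_right_def upt_conv_Cons numeral_2_eq_2)
  then show ?thesis
    using assms(1) is_GSP_Cons_snoc[of "[2..<Suc n] @ map p [1..<n]" 1] by simp
qed

lemma N_left_GSP:
  assumes "n \<ge> 2" "p 1 = 1"
  shows "is_GSP (N_left n p)"
proof -
  have "[1..<Suc n] = 1 # [2..<Suc n]"
    using assms(1) upt_conv_Cons[of 1 "Suc n"] by (simp add: numeral_2_eq_2)
  then have "N_left n p = 1 # ([2..<Suc n] @ map p (rev [2..<Suc n])) @ [1]"
    using assms(2) by (simp add: N_left_def del: upt_Suc)
  then show ?thesis
    using assms(1) is_GSP_Cons_snoc[of "[2..<Suc n] @ map p (rev [2..<Suc n])" 1] by simp
qed

lemma dist_cis_power2: "(dist (cis x) (cis y))\<^sup>2 = 2 - 2 * cos (x - y)"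
proof -
  have "(dist (cis x) (cis y))\<^sup>2 = (cos x - cos y)\<^sup>2 + (sin x - sin y)\<^sup>2"
    by (simp add: dist_norm cmod_power2)
  also have "\<dots> = ((sin x)\<^sup>2 + (cos x)\<^sup>2) + ((sin y)\<^sup>2 + (cos y)\<^sup>2) - 2 * cos (x - y)"
    by (simp only: cos_diff power2_eq_square algebra_simps)
  finally show ?thesis by simp
qed

text \<open>Cosines agree exactly when the angles agree up to sign and a multiple of 2 pi; scaling
  by n / (2 pi) turns this into divisibility.\<close>

lemma cos_2pi_div_eq_iff:
  fixes a b :: int
  assumes "n > 0"
  shows "cos (2 * pi * of_int a / real n) = cos (2 * pi * of_int b / real n) \<longleftrightarrow>
    int n dvd a - b \<or> int n dvd a + b"
proof -
  \<comment> \<open>The integer c is kept general in order to serve for both b and -b.\<close>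
  have angle: "2 * pi * of_int a / real n = 2 * pi * of_int c / real n + 2 * of_int m * pi \<longleftrightarrow>
      a - c = int n * m" for c m :: int
  proof -
    have "2 * pi * of_int a / real n = 2 * pi * of_int c / real n + 2 * of_int m * pi \<longleftrightarrow>
        2 * pi * real_of_int (a - c) = 2 * pi * real_of_int (int n * m)"
      using assms by (simp add: field_simps)
    then show ?thesis
      by (simp only: mult_cancel_left of_int_eq_iff) simp
  qed
  have "cos (2 * pi * of_int a / real n) = cos (2 * pi * of_int b / real n) \<longleftrightarrow>
      (\<exists>m::int. a - b = int n * m \<or> a - (- b) = int n * m)"
    unfolding cos_eq Ints_def angle[symmetric] by simp
  then show ?thesis
    by (auto simp: dvd_def)
qed

text \<open>A squared chord is 2 - 2 cos of its central angle, so equal chords mean equal cosines.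
  This reduces the geometry to arithmetic of labels modulo n.\<close>

lemma dist_ngon_vertex_eq_iff:
  assumes "n > 0"
  shows "dist (ngon_vertex n a) (ngon_vertex n b) = dist (ngon_vertex n c) (ngon_vertex n d) \<longleftrightarrow>
    int n dvd (int a - int b) - (int c - int d) \<or> int n dvd (int a - int b) + (int c - int d)"
proof -
  have cos: "(dist (ngon_vertex n i) (ngon_vertex n j))\<^sup>2
      = 2 - 2 * cos (2 * pi * of_int (int i - int j) / real n)" for i j
    by (simp add: ngon_vertex_def dist_cis_power2 diff_divide_distrib right_diff_distrib)
  have "dist (ngon_vertex n a) (ngon_vertex n b) = dist (ngon_vertex n c) (ngon_vertex n d) \<longleftrightarrow>
      (dist (ngon_vertex n a) (ngon_vertex n b))\<^sup>2 = (dist (ngon_vertex n c) (ngon_vertex n d))\<^sup>2"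
    by (simp add: power2_eq_iff_nonneg)
  also have "\<dots> \<longleftrightarrow> cos (2 * pi * of_int (int a - int b) / real n)
      = cos (2 * pi * of_int (int c - int d) / real n)"
    unfolding cos by simp
  finally show ?thesis
    unfolding cos_2pi_div_eq_iff[OF assms] .
qed

lemma ngon_rotation_permutes:
  assumes "n > 0"
  shows "ngon_rotation n permutes {1..n}"
proof (rule bij_imp_permutes)
  show "bij_betw (ngon_rotation n) {1..n} {1..n}"
    by (rule bij_betw_byWitness[where f' = "\<lambda>i. if i = 1 then n else i - 1"])
      (use assms in \<open>auto simp: ngon_rotation_def\<close>)
qed (use assms in \<open>auto simp: ngon_rotation_def\<close>)

lemma ngon_reflection_permutes: "ngon_reflection n permutes {1..n}"
proof (rule bij_imp_permutes)
  show "bij_betw (ngon_reflection n) {1..n} {1..n}"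
    by (rule bij_betw_byWitness[where f' = "ngon_reflection n"])
      (auto simp: ngon_reflection_def)
qed (auto simp: ngon_reflection_def)

lemma ngon_rotation_dihedral:
  assumes "n > 0"
  shows "ngon_rotation n \<in> dihedral n"
  using ngon_rotation_permutes[OF assms] assms
  by (auto simp: dihedral_def sym_group_carrier dist_ngon_vertex_eq_iff ngon_rotation_def)

lemma ngon_reflection_dihedral:
  assumes "n > 0"
  shows "ngon_reflection n \<in> dihedral n"
proof -
  \<comment> \<open>Both values are 2 - i modulo n, so the reflection negates differences of labels
    modulo n.\<close>
  have *: "int (ngon_reflection n i) = int n + 2 - int i
      \<or> int (ngon_reflection n i) = 2 - int i" if "i \<in> {1..n}" for i
    using that by (auto simp: ngon_reflection_def)
  have "int n dvd (int (ngon_reflection n i) - int (ngon_reflection n j)) + (int i - int j)"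
    if "i \<in> {1..n}" "j \<in> {1..n}" for i j
    using *[OF that(1)] *[OF that(2)] by auto
  then show ?thesis
    using ngon_reflection_permutes
    by (auto simp: dihedral_def sym_group_carrier dist_ngon_vertex_eq_iff[OF assms])
qed

lemma dihedral_subgroup: "subgroup (dihedral n) (sym_group n)"
proof -
  interpret group "sym_group n" by (rule sym_group_is_group)
  show ?thesis
  proof (rule subgroupI)
    show "dihedral n \<subseteq> carrier (sym_group n)"
      by (auto simp: dihedral_def)
    have "id \<in> dihedral n"
      by (auto simp: dihedral_def sym_group_carrier permutes_id)
    then show "dihedral n \<noteq> {}" by blast
  next
    fix p assume p: "p \<in> dihedral n"
    then have perm: "p permutes {1..n}"
      by (simp add: dihedral_def sym_group_carrier)
    have "inv' p i \<in> {1..n}" if "i \<in> {1..n}" for i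
      using permutes_in_image[OF permutes_inv[OF perm]] that by blast
    \<comment> \<open>Invariance under \<open>p\<close>, applied to the preimages of i and j and
      read backwards, is invariance under \<open>inv' p\<close>.\<close>
    then have "dist (ngon_vertex n (p (inv' p i))) (ngon_vertex n (p (inv' p j)))
        = dist (ngon_vertex n (inv' p i)) (ngon_vertex n (inv' p j))"
      if "i \<in> {1..n}" "j \<in> {1..n}" for i j
      using p that unfolding dihedral_def by blast
    then have "inv' p \<in> dihedral n"
      using permutes_inv[OF perm]
      by (simp add: dihedral_def sym_group_carrier permutes_inverses[OF perm])
    then show "inv\<^bsub>sym_group n\<^esub> p \<in> dihedral n"
      using p by (simp add: dihedral_def)
  next
    fix p q assume "p \<in> dihedral n" "q \<in> dihedral n"
    moreover have "q i \<in> {1..n}" if "i \<in> {1..n}" for i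
      using calculation that permutes_in_image[of q "{1..n}" i]
      unfolding dihedral_def sym_group_carrier by blast
    ultimately show "p \<otimes>\<^bsub>sym_group n\<^esub> q \<in> dihedral n"
      by (simp add: dihedral_def sym_group_mult sym_group_carrier permutes_compose)
  qed
qed

text \<open>Only i and its mirror image in the axis through vertex 1 have the distance of i from
  vertex 1.\<close>

lemma dihedral_fix1:
  assumes "p \<in> dihedral n" "p 1 = 1" "i \<in> {1..n}"
  shows "p i = i \<or> p i + i = n + 2"
proof -
  have n: "n > 0" and pi: "p i \<in> {1..n}"
    using assms permutes_in_image[of p "{1..n}" i] by (auto simp: dihedral_def sym_group_carrier)
  have "dist (ngon_vertex n (p i)) (ngon_vertex n (p 1)) = dist (ngon_vertex n i) (ngon_vertex n 1)"
    using assms(1,3) n unfolding dihedral_def by simp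
  then consider "int n dvd int (p i) - int i" | "int n dvd int (p i) + int i - 2"
    unfolding dist_ngon_vertex_eq_iff[OF n] assms(2) by (force simp: algebra_simps)
  then show ?thesis
  proof cases
    case 1
    then show ?thesis
      using pi assms(3) zdvd_not_zless[of "\<bar>int (p i) - int i\<bar>" "int n"] by fastforce
  next
    case 2
    show ?thesis
    \<comment> \<open>The multiple \<open>p i + i - 2\<close> of n lies between 0 and 2n - 2, so it
      is 0 or n; the value 0 forces \<open>p i\<close> = i = 1.\<close>
    proof (cases "p i + i = 2")
      case True
      then show ?thesis using pi assms(3) by auto
    next
      case False
      have "int n dvd int (p i) + int i - 2 - int n"
        using 2 by (simp add: dvd_diff)
      moreover have "\<bar>int (p i) + int i - 2 - int n\<bar> < int n"
        using False pi assms(3) by auto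
      ultimately have "int (p i) + int i - 2 - int n = 0"
        using zdvd_not_zless[of "\<bar>int (p i) + int i - 2 - int n\<bar>" "int n"] by fastforce
      then show ?thesis by linarith
    qed
  qed
qed

text \<open>By \<open>dihedral_fix1\<close> each vertex is fixed or mirrored; the distance to vertex
  2 excludes a mirror image different from i.\<close>

lemma dihedral_fix12_eq_id:
  assumes "n \<ge> 3" "p \<in> dihedral n" "p 1 = 1" "p 2 = 2"
  shows "p = id"
proof
  fix i
  show "p i = id i"
  proof (cases "i \<in> {1..n}")
    case False
    then show ?thesis
      using assms(2) permutes_not_in[of p "{1..n}" i] by (simp add: dihedral_def sym_group_carrier)
  next
    case True
    have "p i = i" if sum: "p i + i = n + 2"
    proof -
      have pi: "p i \<in> {1..n}"
        using assms(2) True permutes_in_image[of p "{1..n}" i]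
        by (simp add: dihedral_def sym_group_carrier)
      have "dist (ngon_vertex n (p i)) (ngon_vertex n (p 2))
          = dist (ngon_vertex n i) (ngon_vertex n 2)"
        using assms(1,2) True unfolding dihedral_def by simp
      then consider "int n dvd int (p i) - int i" | "int n dvd int (p i) + int i - 4"
        using assms(1) unfolding assms(4) by (force simp: dist_ngon_vertex_eq_iff algebra_simps)
      then show ?thesis
      proof cases
        case 1
        then show ?thesis
          using pi True zdvd_not_zless[of "\<bar>int (p i) - int i\<bar>" "int n"] by fastforce
      next
        case 2
        \<comment> \<open>For n \<ge> 3 this number lies strictly between 0 and n, so n cannot
          divide it.\<close>
        moreover have "int (p i) + int i - 4 = int n - 2"
          using sum by linarith
        ultimately show ?thesis
          using assms(1) zdvd_not_zless[of "int n - 2" "int n"] by simp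
      qed
    qed
    then show ?thesis
      using dihedral_fix1[OF assms(2,3) True] by auto
  qed
qed

lemma dihedral_generate:
  assumes n: "n \<ge> 3"
  shows "dihedral n = generate (sym_group n) {ngon_rotation n, ngon_reflection n}"
    (is "_ = generate ?G {?r, ?s}")
proof
  interpret group ?G by (rule sym_group_is_group)
  interpret D: subgroup "dihedral n" ?G by (rule dihedral_subgroup)
  have r: "?r \<in> dihedral n" and s: "?s \<in> dihedral n"
    using n by (simp_all add: ngon_rotation_dihedral ngon_reflection_dihedral)
  then show "generate ?G {?r, ?s} \<subseteq> dihedral n"
    by (intro generate_subgroup_incl dihedral_subgroup) auto
  have fix1: "p \<in> generate ?G {?r, ?s}" if p: "p \<in> dihedral n" "p 1 = 1" for p
  proof -
    have "p 2 = 2 \<or> p 2 = n"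
      using dihedral_fix1[OF p, of 2] n by auto
    then show ?thesis
    proof
      assume "p 2 = 2"
      then have "p = \<one>\<^bsub>?G\<^esub>"
        using dihedral_fix12_eq_id[OF n p] by (simp add: sym_group_one)
      then show ?thesis by (simp add: generate.one)
    next
      assume "p 2 = n"
      \<comment> \<open>The reflection fixes 1 and sends n back to 2.\<close>
      then have "(?s \<otimes>\<^bsub>?G\<^esub> p) 1 = 1" "(?s \<otimes>\<^bsub>?G\<^esub> p) 2 = 2"
        using p n by (auto simp: sym_group_mult ngon_reflection_def)
      then have "?s \<otimes>\<^bsub>?G\<^esub> p = \<one>\<^bsub>?G\<^esub>"
        using dihedral_fix12_eq_id[OF n D.m_closed[OF s p(1)]] by (simp add: sym_group_one)
      then have "p = inv\<^bsub>?G\<^esub> ?s"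
        using s p(1) D.mem_carrier by (metis inv_equality inv_inv)
      then show ?thesis by (simp add: generate.inv del: sym_group_inv_equality)
    qed
  qed
  \<comment> \<open>Induction on the number of rotation steps from vertex 1 to its image; each step
    strips one rotation from the left of \<open>p\<close>.\<close>
  have "p \<in> generate ?G {?r, ?s}" if "p \<in> dihedral n" "p 1 = Suc k" for p k
    using that
  proof (induction k arbitrary: p)
    case 0
    then show ?case using fix1 by simp
  next
    case (Suc k)
    define q where "q = inv\<^bsub>?G\<^esub> ?r \<otimes>\<^bsub>?G\<^esub> p"
    have q: "q \<in> dihedral n"
      using r Suc.prems(1) by (simp add: q_def del: sym_group_inv_equality)
    have p: "p = ?r \<otimes>\<^bsub>?G\<^esub> q"
      using r Suc.prems(1) D.mem_carrier
      by (simp add: q_def m_assoc[symmetric] del: sym_group_inv_equality)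
    have perm: "?r permutes {1..n}"
      using n by (intro ngon_rotation_permutes) simp
    have "p 1 \<in> {1..n}"
      using Suc.prems(1) n permutes_in_image[of p "{1..n}" 1]
      by (simp add: dihedral_def sym_group_carrier)
    \<comment> \<open>Since \<open>p 1\<close> = k + 2 is at most n, k + 1 is below n and the
      rotation does not wrap around.\<close>
    then have "?r (Suc k) = p 1"
      using Suc.prems(2) by (simp add: ngon_rotation_def)
    then have "?r (Suc k) = ?r (q 1)"
      by (subst (asm) p) (simp add: sym_group_mult)
    then have "q 1 = Suc k"
      using permutes_inj[OF perm] by (metis injD)
    then have "q \<in> generate ?G {?r, ?s}"
      by (rule Suc.IH[OF q])
    then show ?case
      unfolding p by (intro generate.eng) (auto intro: generate.incl)
  qed
  moreover have "p 1 = Suc (p 1 - 1)" if "p \<in> dihedral n" for p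
    using that n permutes_in_image[of p "{1..n}" 1] by (simp add: dihedral_def sym_group_carrier)
  ultimately show "dihedral n \<subseteq> generate ?G {?r, ?s}" by blast
qed

theorem theorem3p2:
  fixes n :: nat
  assumes "n \<ge> 3"
  shows "\<exists>\<sigma>\<in>GSPP_right n. \<exists>\<tau>\<in>GSPP_left n. dihedral n = generate (sym_group n) {\<sigma>, \<tau>}"
proof (intro bexI)
  show "dihedral n = generate (sym_group n) {ngon_rotation n, ngon_reflection n}"
    using assms by (rule dihedral_generate)
  show "ngon_reflection n \<in> GSPP_left n"
    using assms ngon_reflection_permutes
    by (simp add: GSPP_left_def sym_group_carrier N_left_GSP ngon_reflection_def)
  show "ngon_rotation n \<in> GSPP_right n"
    using assms ngon_rotation_permutes
    by (simp add: GSPP_right_def sym_group_carrier N_right_GSP ngon_rotation_def)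
qed

end
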